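(* Let $\mathbb{F}$ be a totally ordered division ring and let $(T,\trianglelefteq,\sim)$ be a colored tree. The relation $\equiv$ on $\mathbb{F}^{(T)}_+$ is cancellative: for all $x,y,z\in\mathbb{F}^{(T)}_+$, if $x+z\equiv y+z$, then $x\equiv y$.
   Context: A tree is a poset $(T,\trianglelefteq)$ such that $\{q\in T\mid q\trianglelefteq p\}$ is a finite chain for every $p\in T$. Write $p\prec q$ if $p$ is a lower cover of $q$; every non-minimal $q$ has a unique lower cover, denoted $q_*$. A coloring of $T$ is an equivalence relation $\sim$ on $T$ such that (1) the $\sim$-class $[p]$ of every non-minimal $p$ is finite with at least two elements; (2) if $p\sim q$, then either both $p,q$ are minimal or $p_*=q_*$. A colored tree is a triple $(T,\trianglelefteq,\sim)$ with $\sim$ a coloring of the tree $(T,\trianglelefteq)$. Put $\mathcal{M}_T=\{(p,[q])\mid p,q\in T,\ p\prec q\}$. Let $\mathbb{F}^{(T)}$ be the free left $\mathbb{F}$-vector space of finitely supported maps $T\to\mathbb{F}$, with canonical basis $(\dot p)_{p\in T}$, and $\mathbb{F}^{(T)}_+=\{x\in\mathbb{F}^{(T)}\mid x(p)\geq0\text{ for all }p\in T\}$. For $x,y\in\mathbb{F}^{(T)}_+$, write $x\longrightarrow^{1}y$ if there are $(p,I)\in\mathcal{M}_T$, $\lambda\geq0$ in $\mathbb{F}$ and $z\in\mathbb{F}^{(T)}_+$ with $x=\frac{\lambda}{|I|}\sum_{q\in I}\dot q+z$ and $y=\lambda\dot p+z$. Let $x\longrightarrow^{0}y$ mean $x=y$,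 let $x\longrightarrow^{n+1}y$ mean that $x\longrightarrow^{1}z\longrightarrow^{n}y$ for some $z\in\mathbb{F}^{(T)}_+$, and let $x\longrightarrow^{*}y$ mean $x\longrightarrow^{n}y$ for some natural number $n$. Write $x\equiv y$ if there exists $u\in\mathbb{F}^{(T)}_+$ with $x\longrightarrow^{*}u$ and $y\longrightarrow^{*}u$. *)

theory Defs
  imports "HOL-Library.Poly_Mapping"
begin

text \<open>
  A poset is a carrier set \<open>T\<close> with a relation \<open>le \<subseteq> T \<times> T\<close>, and \<open>(p, q) \<in> le\<close> stands for
  \<open>p \<unlhd> q\<close>. The carrier may be empty, and minimal elements need not be unique.
\<close>

definition tree :: "'a set \<Rightarrow> 'a rel \<Rightarrow> bool" where
  "tree T le \<longleftrightarrow> partial_order_on T le \<and>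
     (\<forall>p\<in>T. finite {q \<in> T. (q, p) \<in> le} \<and> {q \<in> T. (q, p) \<in> le} \<in> Chains le)"

definition lower_cover :: "'a set \<Rightarrow> 'a rel \<Rightarrow> 'a \<Rightarrow> 'a \<Rightarrow> bool" where
  "lower_cover T le p q \<longleftrightarrow> p \<in> T \<and> q \<in> T \<and> (p, q) \<in> le \<and> p \<noteq> q \<and>
     \<not> (\<exists>r\<in>T. (p, r) \<in> le \<and> (r, q) \<in> le \<and> r \<noteq> p \<and> r \<noteq> q)"

definition minimal_in :: "'a set \<Rightarrow> 'a rel \<Rightarrow> 'a \<Rightarrow> bool" where
  "minimal_in T le p \<longleftrightarrow> p \<in> T \<and> (\<forall>q\<in>T. (q, p) \<in> le \<longrightarrow> q = p)"

text \<open>The element \<open>q\<^sub>*\<close>; meaningful only if \<open>q\<close> is not minimal (see \<open>tree_lower_cover_unique\<close>).\<close>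

definition the_lower_cover :: "'a set \<Rightarrow> 'a rel \<Rightarrow> 'a \<Rightarrow> 'a" where
  "the_lower_cover T le q = (THE p. lower_cover T le p q)"

text \<open>
  Since \<open>the_lower_cover\<close> is total, the equation \<open>p\<^sub>* = q\<^sub>*\<close> is guarded by the requirement that
  both sides be defined. The block of \<open>p\<close> is \<open>sim `` {p}\<close>.
\<close>

definition coloring :: "'a set \<Rightarrow> 'a rel \<Rightarrow> 'a rel \<Rightarrow> bool" where
  "coloring T le sim \<longleftrightarrow> equiv T sim \<and>
     (\<forall>p\<in>T. \<not> minimal_in T le p \<longrightarrow> finite (sim `` {p}) \<and> card (sim `` {p}) \<ge> 2) \<and>
     (\<forall>p q. (p, q) \<in> sim \<longrightarrow>
        (minimal_in T le p \<and> minimal_in T le q) \<or>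
        (\<not> minimal_in T le p \<and> \<not> minimal_in T le q \<and>
          the_lower_cover T le p = the_lower_cover T le q))"

definition colored_tree :: "'a set \<Rightarrow> 'a rel \<Rightarrow> 'a rel \<Rightarrow> bool" where
  "colored_tree T le sim \<longleftrightarrow> tree T le \<and> coloring T le sim"

definition cover_blocks :: "'a set \<Rightarrow> 'a rel \<Rightarrow> 'a rel \<Rightarrow> ('a \<times> 'a set) set" where
  "cover_blocks T le sim = {(p, sim `` {q}) | p q. p \<in> T \<and> q \<in> T \<and> lower_cover T le p q}"

text \<open>
  The left vector space \<open>F\<^bsup>(T)\<^esup>\<close> consists of the \<open>x :: 'a \<Rightarrow>\<^sub>0 'f\<close> with
  \<open>Poly_Mapping.keys x \<subseteq> T\<close>. A totally ordered, possibly noncommutative, division ring is a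
  type of sort \<open>{division_ring, linordered_ring_strict}\<close>; the operations \<open>abs\<close> and \<open>/\<close>
  required by this sort are determined by the ordered ring structure.
\<close>

definition scale :: "'f \<Rightarrow> ('a \<Rightarrow>\<^sub>0 'f) \<Rightarrow> ('a \<Rightarrow>\<^sub>0 'f::{division_ring, linordered_ring_strict})" where
  "scale c x = Poly_Mapping.map (\<lambda>a. c * a) x"

definition basis_vec :: "'a \<Rightarrow> ('a \<Rightarrow>\<^sub>0 'f::{division_ring, linordered_ring_strict})" where
  "basis_vec p = Poly_Mapping.single p 1"

definition pos_cone :: "'a set \<Rightarrow> ('a \<Rightarrow>\<^sub>0 'f::{division_ring, linordered_ring_strict}) set" where
  "pos_cone T = {x. Poly_Mapping.keys x \<subseteq> T \<and> (\<forall>p\<in>T. Poly_Mapping.lookup x p \<ge> 0)}"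

definition step1 :: "'a set \<Rightarrow> 'a rel \<Rightarrow> 'a rel \<Rightarrow>
    ('a \<Rightarrow>\<^sub>0 'f::{division_ring, linordered_ring_strict}) \<Rightarrow> ('a \<Rightarrow>\<^sub>0 'f) \<Rightarrow> bool" where
  "step1 T le sim x y \<longleftrightarrow> x \<in> pos_cone T \<and> y \<in> pos_cone T \<and>
     (\<exists>p I c z. (p, I) \<in> cover_blocks T le sim \<and> c \<ge> 0 \<and> z \<in> pos_cone T \<and>
        x = scale (c / of_nat (card I)) (\<Sum>q\<in>I. basis_vec q) + z \<and>
        y = scale c (basis_vec p) + z)"

primrec stepn :: "'a set \<Rightarrow> 'a rel \<Rightarrow> 'a rel \<Rightarrow> nat \<Rightarrow>
    ('a \<Rightarrow>\<^sub>0 'f::{division_ring, linordered_ring_strict}) \<Rightarrow> ('a \<Rightarrow>\<^sub>0 'f) \<Rightarrow> bool" where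
  "stepn T le sim 0 x y \<longleftrightarrow> x = y"
| "stepn T le sim (Suc n) x y \<longleftrightarrow>
     (\<exists>z\<in>pos_cone T. step1 T le sim x z \<and> stepn T le sim n z y)"

definition steps :: "'a set \<Rightarrow> 'a rel \<Rightarrow> 'a rel \<Rightarrow>
    ('a \<Rightarrow>\<^sub>0 'f::{division_ring, linordered_ring_strict}) \<Rightarrow> ('a \<Rightarrow>\<^sub>0 'f) \<Rightarrow> bool" where
  "steps T le sim x y \<longleftrightarrow> (\<exists>n. stepn T le sim n x y)"

definition joinable :: "'a set \<Rightarrow> 'a rel \<Rightarrow> 'a rel \<Rightarrow>
    ('a \<Rightarrow>\<^sub>0 'f::{division_ring, linordered_ring_strict}) \<Rightarrow> ('a \<Rightarrow>\<^sub>0 'f) \<Rightarrow> bool" where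
  "joinable T le sim x y \<longleftrightarrow>
     (\<exists>u\<in>pos_cone T. steps T le sim x u \<and> steps T le sim y u)"

lemma lookup_scale: "Poly_Mapping.lookup (scale c x) p = c * Poly_Mapping.lookup x p"
  by (simp add: scale_def Poly_Mapping.map.rep_eq when_def)

lemma tree_lower_cover_unique:
  assumes "tree T le" "q \<in> T" "\<not> minimal_in T le q"
  shows "\<exists>!p. lower_cover T le p q"
proof -
  let ?D = "{r \<in> T. (r, q) \<in> le \<and> r \<noteq> q}"
  let ?m = "\<lambda>r. card {s \<in> T. (s, r) \<in> le}"
  have po: "antisym le" "trans le" "\<And>r. r \<in> T \<Longrightarrow> (r, r) \<in> le"
    using assms(1) by (auto simp: tree_def order_on_defs refl_on_def)
  have fin: "finite {s \<in> T. (s, r) \<in> le}" if "r \<in> T" for r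
    using assms(1) that by (auto simp: tree_def)
  have chain: "(a, b) \<in> le \<or> (b, a) \<in> le" if "a \<in> ?D" "b \<in> ?D" for a b
    using assms(1,2) that by (auto simp: tree_def Chains_def)
  have less: "?m a < ?m b" if "(a, b) \<in> le" "a \<noteq> b" "a \<in> T" "b \<in> T" for a b
  proof (rule psubset_card_mono[OF fin[OF \<open>b \<in> T\<close>]])
    show "{s \<in> T. (s, a) \<in> le} \<subset> {s \<in> T. (s, b) \<in> le}"
      using that po(3)[of b] transD[OF po(2)] antisymD[OF po(1)] by blast
  qed
  have finD: "finite ?D"
    using fin[OF assms(2)] by (rule rev_finite_subset) auto
  have "?D \<noteq> {}"
    using assms(2,3) by (auto simp: minimal_in_def)
  then have "Max (?m ` ?D) \<in> ?m ` ?D"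
    using finD by (intro Max_in) auto
  then obtain p where p: "p \<in> ?D" "?m p = Max (?m ` ?D)" by auto
  have max: "?m r \<le> ?m p" if "r \<in> ?D" for r
    unfolding p(2) using finD that by (intro Max_ge) auto
  have below: "(r, p) \<in> le" if "r \<in> ?D" for r
    using chain[OF that p(1)] less[of p r] max[OF that] that p(1) by fastforce
  show ?thesis
  proof (rule ex1I[of _ p])
    show "lower_cover T le p q"
      using p(1) below assms(2) antisymD[OF po(1)] unfolding lower_cover_def by blast
  next
    fix r assume "lower_cover T le r q"
    then show "r = p"
      using below[of r] p(1) unfolding lower_cover_def by blast
  qed
qed

end

theory Submission
  imports Defs
begin

text \<open>
  A step \<open>x \<longrightarrow>\<^sup>1 y\<close> changes \<open>x\<close> by a multiple of a vector attached to a cover block \<open>(p, I)\<close>,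
  the average of \<open>I\<close> minus \<open>p\<close>. Hence joinable elements differ by an element of the subspace
  spanned by these vectors (\<open>joinable_imp_diff\<close>). The converse
  (\<open>joinable_if_diff\<close>) holds on the positive cone, so that \<open>x \<equiv> y\<close> depends on \<open>x - y\<close> only;
  cancellation follows at once, because \<open>(x + z) - (y + z) = x - y\<close>.

  For the converse, write \<open>x - y\<close> as a combination of finitely many cover blocks and pick a block
  \<open>(p, I)\<close> among them with \<open>p\<close> as high in the tree as possible. An element of \<open>I\<close> occurs in no other
  chosen block and is the lower cover of none, so \<open>x - y\<close> takes the constant value \<open>c / |I|\<close> on \<open>I\<close>,
  where \<open>c\<close> is the coefficient of the block. If \<open>c\<close> is nonnegative, then \<open>y \<ge> 0\<close> forces \<open>x\<close> to be at least \<open>c / |I|\<close> on all of \<open>I\<close>, so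
  \<open>x\<close> has a step which removes the block from the difference. If \<open>c\<close> is negative, \<open>y\<close> has
  such a step. Induction on the number of blocks joins \<open>x\<close> to \<open>y\<close>, since a
  step prepended on either side preserves joinability.
\<close>

definition block_change ::
    "('a \<times> 'a set) \<Rightarrow> 'f \<Rightarrow> ('a \<Rightarrow>\<^sub>0 'f::{division_ring, linordered_ring_strict})" where
  "block_change b c =
     scale (c / of_nat (card (snd b))) (\<Sum>q\<in>snd b. basis_vec q) - scale c (basis_vec (fst b))"

text \<open>
  The left subspace generated by all steps; unlike in a step, the coefficients may be negative.
\<close>

definition change_space :: "'a set \<Rightarrow> 'a rel \<Rightarrow> 'a rel \<Rightarrow>
    ('a \<Rightarrow>\<^sub>0 'f::{division_ring, linordered_ring_strict}) set" where
  "change_space T le sim =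
     {d. \<exists>S c. finite S \<and> S \<subseteq> cover_blocks T le sim \<and> d = (\<Sum>b\<in>S. block_change b (c b))}"

lemma scale_diff_left: "scale (a - b) x = scale a x - scale b x"
  by (rule poly_mapping_eqI) (simp add: lookup_scale lookup_minus left_diff_distrib)

lemma block_change_diff: "block_change b (a - c) = block_change b a - block_change b c"
  by (simp add: block_change_def diff_divide_distrib scale_diff_left)

lemma block_change_0: "block_change b 0 = 0"
  using block_change_diff[of b 0 0] by simp

lemma block_change_minus: "block_change b (- c) = - block_change b c"
  using block_change_diff[of b 0 c] by (simp add: block_change_0)

lemma lookup_sum_basis_vec:
  assumes "finite I"
  shows "Poly_Mapping.lookup (\<Sum>q\<in>I. basis_vec q) r = (if r \<in> I then 1 else 0)"
  using assms by (simp add: lookup_sum basis_vec_def lookup_single when_def)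

lemma lookup_block_change:
  assumes "finite I"
  shows "Poly_Mapping.lookup (block_change (p, I) c) r =
    (if r \<in> I then c / of_nat (card I) else 0) - (if r = p then c else 0)"
  using assms
  by (simp add: block_change_def lookup_minus lookup_scale lookup_sum_basis_vec)
     (simp add: basis_vec_def lookup_single when_def)

lemma change_space_0: "0 \<in> change_space T le sim"
  unfolding change_space_def by (auto intro!: exI[of _ "{}"])

lemma block_change_in_change_space:
  assumes "b \<in> cover_blocks T le sim"
  shows "block_change b c \<in> change_space T le sim"
  unfolding change_space_def using assms by (auto intro!: exI[of _ "{b}"] exI[of _ "\<lambda>_. c"])

lemma change_space_diff:
  assumes "d \<in> change_space T le sim" "e \<in> change_space T le sim"
  shows "d - e \<in> change_space T le sim"
proof -
  obtain S c where S: "finite S" "S \<subseteq> cover_blocks T le sim"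
    and d: "d = (\<Sum>b\<in>S. block_change b (c b))"
    using assms(1) by (auto simp: change_space_def)
  obtain R a where R: "finite R" "R \<subseteq> cover_blocks T le sim"
    and e: "e = (\<Sum>b\<in>R. block_change b (a b))"
    using assms(2) by (auto simp: change_space_def)
  let ?c = "\<lambda>b. if b \<in> S then c b else 0" and ?a = "\<lambda>b. if b \<in> R then a b else 0"
  have d': "d = (\<Sum>b\<in>S \<union> R. block_change b (?c b))"
    unfolding d using S R by (intro sum.mono_neutral_cong_left) (auto simp: block_change_0)
  have e': "e = (\<Sum>b\<in>S \<union> R. block_change b (?a b))"
    unfolding e using S R by (intro sum.mono_neutral_cong_left) (auto simp: block_change_0)
  have "d - e = (\<Sum>b\<in>S \<union> R. block_change b (?c b - ?a b))"
    unfolding d' e' block_change_diff sum_subtractf ..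
  then show ?thesis
    using S R unfolding change_space_def
    by (auto intro!: exI[of _ "S \<union> R"] exI[of _ "\<lambda>b. ?c b - ?a b"])
qed

lemma change_space_add:
  assumes "d \<in> change_space T le sim" "e \<in> change_space T le sim"
  shows "d + e \<in> change_space T le sim"
  using change_space_diff[OF assms(1) change_space_diff[OF change_space_0 assms(2)]] by simp

lemma step1_imp_diff:
  assumes "step1 T le sim x y"
  shows "x - y \<in> change_space T le sim"
proof -
  obtain p I c z where b: "(p, I) \<in> cover_blocks T le sim"
    and x: "x = scale (c / of_nat (card I)) (\<Sum>q\<in>I. basis_vec q) + z"
    and y: "y = scale c (basis_vec p) + z"
    using assms unfolding step1_def by blast
  have "x - y = block_change (p, I) c"
    by (simp add: x y block_change_def)
  then show ?thesis
    using block_change_in_change_space[OF b] by simp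
qed

lemma stepn_imp_diff:
  "stepn T le sim n x y \<Longrightarrow> x - y \<in> change_space T le sim"
proof (induction n arbitrary: x)
  case 0
  then show ?case by (simp add: change_space_0)
next
  case (Suc n)
  then obtain z where "step1 T le sim x z" "stepn T le sim n z y"
    by auto
  then have "(x - z) + (z - y) \<in> change_space T le sim"
    using Suc.IH by (blast intro: change_space_add step1_imp_diff)
  then show ?case by simp
qed

lemma joinable_imp_diff:
  assumes "joinable T le sim x y"
  shows "x - y \<in> change_space T le sim"
proof -
  obtain u m n where "stepn T le sim m x u" "stepn T le sim n y u"
    using assms by (auto simp: joinable_def steps_def)
  then have "(x - u) - (y - u) \<in> change_space T le sim"
    by (intro change_space_diff stepn_imp_diff)
  then show ?thesis by simp
qed

lemma joinable_sym: "joinable T le sim x y \<Longrightarrow> joinable T le sim y x"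
  by (auto simp: joinable_def)

lemma joinable_step1:
  assumes "step1 T le sim x x'" "joinable T le sim x' y"
  shows "joinable T le sim x y"
proof -
  have "x' \<in> pos_cone T" using assms(1) by (simp add: step1_def)
  then have "steps T le sim x u" if "steps T le sim x' u" for u
    using that assms(1) unfolding steps_def by (metis stepn.simps(2))
  then show ?thesis using assms(2) by (auto simp: joinable_def)
qed

lemma cover_block_member:
  assumes "colored_tree T le sim" "(p, I) \<in> cover_blocks T le sim" "r \<in> I"
  shows "lower_cover T le p r" "I = sim `` {r}" "finite I"
proof -
  have tree: "tree T le" and col: "coloring T le sim"
    using assms(1) by (auto simp: colored_tree_def)
  obtain q where q: "q \<in> T" "lower_cover T le p q" "I = sim `` {q}"
    using assms(2) by (auto simp: cover_blocks_def)
  have qr: "(q, r) \<in> sim" using assms(3) q by simp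
  have eq: "equiv T sim" using col by (simp add: coloring_def)
  have rT: "r \<in> T" using eq qr by (auto simp: equiv_def)
  show "I = sim `` {r}" using equiv_class_eq[OF eq qr] q by simp
  have nq: "\<not> minimal_in T le q"
    using q(2) by (auto simp: minimal_in_def lower_cover_def)
  then show "finite I" using col q by (auto simp: coloring_def)
  have nr: "\<not> minimal_in T le r" and same: "the_lower_cover T le q = the_lower_cover T le r"
    using col qr nq unfolding coloring_def by blast+
  have "the_lower_cover T le q = p"
    using the1_equality[OF tree_lower_cover_unique[OF tree q(1) nq] q(2)]
    by (simp add: the_lower_cover_def)
  moreover have "lower_cover T le (the_lower_cover T le r) r"
    using theI'[OF tree_lower_cover_unique[OF tree rT nr]] by (simp add: the_lower_cover_def)
  ultimately show "lower_cover T le p r" using same by simp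
qed

text \<open>
  Color classes partition \<open>T\<close>, and a non-minimal element has only one lower cover.
\<close>

lemma cover_block_inj:
  assumes "colored_tree T le sim"
    and "(p, I) \<in> cover_blocks T le sim" "(p', J) \<in> cover_blocks T le sim"
    and "r \<in> I" "r \<in> J"
  shows "(p, I) = (p', J)"
proof -
  have lc: "lower_cover T le p r" "lower_cover T le p' r"
    using cover_block_member(1)[OF assms(1,2,4)] cover_block_member(1)[OF assms(1,3,5)] .
  then have "r \<in> T" "\<not> minimal_in T le r"
    by (auto simp: lower_cover_def minimal_in_def)
  then have "\<exists>!p. lower_cover T le p r"
    using assms(1) by (intro tree_lower_cover_unique) (auto simp: colored_tree_def)
  then have "p = p'" using lc by blast
  then show ?thesis
    using cover_block_member(2)[OF assms(1,2,4)] cover_block_member(2)[OF assms(1,3,5)] by simp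
qed

lemma cover_block_finite:
  assumes "colored_tree T le sim" "(p, I) \<in> cover_blocks T le sim"
  shows "finite I" "I \<subseteq> T" "p \<in> T"
proof -
  show "finite I"
    using cover_block_member(3)[OF assms] by fastforce
  show "I \<subseteq> T"
    using cover_block_member(1)[OF assms] by (auto simp: lower_cover_def)
  show "p \<in> T" using assms(2) by (auto simp: cover_blocks_def)
qed

lemma height_less:
  assumes "tree T le" "lower_cover T le p q"
  shows "card {s \<in> T. (s, p) \<in> le} < card {s \<in> T. (s, q) \<in> le}"
proof (rule psubset_card_mono)
  have pq: "p \<in> T" "q \<in> T" "(p, q) \<in> le" "p \<noteq> q"
    using assms(2) by (auto simp: lower_cover_def)
  then show "finite {s \<in> T. (s, q) \<in> le}"
    using assms(1) by (auto simp: tree_def)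
  have "antisym le" "trans le" "(q, q) \<in> le"
    using assms(1) pq(2) by (auto simp: tree_def order_on_defs refl_on_def)
  then show "{s \<in> T. (s, p) \<in> le} \<subset> {s \<in> T. (s, q) \<in> le}"
    using pq by (auto dest: transD antisymD)
qed

text \<open>
  Maximality of the height of \<open>p\<close> keeps the elements of \<open>I\<close>, which are higher than \<open>p\<close>, from
  being the lower cover of another block in \<open>S\<close>.
\<close>

lemma exists_top_block:
  assumes ct: "colored_tree T le sim"
    and S: "finite S" "S \<noteq> {}" "S \<subseteq> cover_blocks T le sim"
  shows "\<exists>p I. (p, I) \<in> S \<and>
    (\<forall>c :: 'a \<times> 'a set \<Rightarrow> 'f::{division_ring, linordered_ring_strict}. \<forall>r\<in>I.
    Poly_Mapping.lookup (\<Sum>b\<in>S. block_change b (c b)) r = c (p, I) / of_nat (card I))"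
proof -
  define h where "h p = card {s \<in> T. (s, p) \<in> le}" for p
  have "Max ((h \<circ> fst) ` S) \<in> (h \<circ> fst) ` S"
    using S by (intro Max_in) auto
  then obtain p I where pI: "(p, I) \<in> S" "h p = Max ((h \<circ> fst) ` S)"
    by auto
  have top: "h (fst b) \<le> h p" if "b \<in> S" for b
    unfolding pI(2) using S(1) that by (intro Max_ge) auto
  have b: "(p, I) \<in> cover_blocks T le sim" using pI S by auto
  have "Poly_Mapping.lookup (\<Sum>b\<in>S. block_change b (c b)) r = c (p, I) / of_nat (card I)"
    if r: "r \<in> I" for c :: "'a \<times> 'a set \<Rightarrow> 'f" and r
  proof -
    have "h p < h r"
      using height_less[of T le] cover_block_member(1)[OF ct b r] ct
      unfolding h_def colored_tree_def by blast
    then have not_base: "r \<noteq> fst b" if "b \<in> S" for b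
      using top[OF that] by auto
    have only: "Poly_Mapping.lookup (block_change b (c b)) r =
      (if b = (p, I) then c b / of_nat (card I) else 0)" if "b \<in> S" for b
    proof (cases b)
      case (Pair p' J)
      then have b': "(p', J) \<in> cover_blocks T le sim" using S that by auto
      have "r \<noteq> p'" using not_base[OF that] Pair by simp
      moreover have "r \<in> J \<longleftrightarrow> (p', J) = (p, I)"
        using cover_block_inj[OF ct b b' r] r by blast
      ultimately show ?thesis
        unfolding Pair lookup_block_change[OF cover_block_finite(1)[OF ct b']] by simp
    qed
    show ?thesis
      using only pI S by (simp add: lookup_sum)
  qed
  then show ?thesis using pI(1) by blast
qed

lemma pos_cone_iff:
  "x \<in> pos_cone T \<longleftrightarrow> (\<forall>r. if r \<in> T then Poly_Mapping.lookup x r \<ge> 0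
    else Poly_Mapping.lookup x r = 0)"
  by (auto simp: pos_cone_def in_keys_iff split: if_splits)

text \<open>
  The hypothesis \<open>large\<close> is exactly what makes \<open>x\<close> minus the averaged block, the vector \<open>z\<close> in the
  definition of a step, nonnegative.
\<close>

lemma step1_block_change:
  assumes ct: "colored_tree T le sim" and x: "x \<in> pos_cone T"
    and b: "(p, I) \<in> cover_blocks T le sim" and c: "c \<ge> 0"
    and large: "\<And>r. r \<in> I \<Longrightarrow> c / of_nat (card I) \<le> Poly_Mapping.lookup x r"
  shows "step1 T le sim x (x - block_change (p, I) c)"
proof -
  note fin = cover_block_finite[OF ct b]
  define v where "v = scale (c / of_nat (card I)) (\<Sum>q\<in>I. basis_vec q)"
  have v: "Poly_Mapping.lookup v r = (if r \<in> I then c / of_nat (card I) else 0)" for r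
    using fin by (simp add: v_def lookup_scale lookup_sum_basis_vec)
  have z: "x - v \<in> pos_cone T"
    using x large fin by (auto simp: pos_cone_iff lookup_minus v)
  then have "scale c (basis_vec p) + (x - v) \<in> pos_cone T"
    using fin c
    by (auto simp: pos_cone_iff lookup_add lookup_scale basis_vec_def lookup_single when_def)
  moreover have "x - block_change (p, I) c = scale c (basis_vec p) + (x - v)"
    by (simp add: block_change_def v_def)
  moreover have "x = v + (x - v)" by simp
  ultimately show ?thesis
    using x z b c unfolding step1_def v_def by metis
qed

text \<open>
  The induction removes a top block from the difference. The step that does so starts at \<open>x\<close> or
  at \<open>y\<close>, according to the sign of the coefficient of that block.
\<close>

lemma joinable_if_diff_sum:
  fixes x y :: "'a \<Rightarrow>\<^sub>0 'f::{division_ring, linordered_ring_strict}"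
  assumes ct: "colored_tree T le sim"
  shows "finite S \<Longrightarrow> S \<subseteq> cover_blocks T le sim \<Longrightarrow> x \<in> pos_cone T \<Longrightarrow> y \<in> pos_cone T \<Longrightarrow>
    x - y = (\<Sum>b\<in>S. block_change b (c b)) \<Longrightarrow> joinable T le sim x y"
proof (induction S arbitrary: x y c rule: finite_psubset_induct)
  case (psubset S)
  show ?case
  proof (cases "S = {}")
    case True
    then have "x = y" using psubset.prems by simp
    then show ?thesis
      using psubset.prems unfolding joinable_def steps_def by (metis stepn.simps(1))
  next
    case False
    then obtain p I where pI: "(p, I) \<in> S" and top: "\<And>c r. r \<in> I \<Longrightarrow>
        Poly_Mapping.lookup (\<Sum>b\<in>S. block_change b (c b)) r = c (p, I) / (of_nat (card I) :: 'f)"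
      using exists_top_block[OF ct psubset.hyps(1) False psubset.prems(1)] by blast
    have b: "(p, I) \<in> cover_blocks T le sim" using pI psubset.prems by auto
    \<comment> \<open>The case of a nonnegative coefficient, stated for arbitrary arguments because a negative one
      reduces to it by exchanging the two sides.\<close>
    have reduce: "joinable T le sim x y"
      if x: "x \<in> pos_cone T" and y: "y \<in> pos_cone T"
        and xy: "x - y = (\<Sum>b\<in>S. block_change b (c b))" and c: "c (p, I) \<ge> 0"
      for x y :: "'a \<Rightarrow>\<^sub>0 'f" and c
    proof (rule joinable_step1)
      let ?x' = "x - block_change (p, I) (c (p, I))"
      show step: "step1 T le sim x ?x'"
      proof (rule step1_block_change[OF ct x b c])
        fix r assume r: "r \<in> I"
        then have "0 \<le> Poly_Mapping.lookup y r"
          using y cover_block_finite(2)[OF ct b] by (auto simp: pos_cone_def)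
        moreover have "Poly_Mapping.lookup x r - Poly_Mapping.lookup y r
            = c (p, I) / of_nat (card I)"
          using top[OF r, of c] by (simp flip: xy add: lookup_minus)
        ultimately show "c (p, I) / of_nat (card I) \<le> Poly_Mapping.lookup x r"
          by (metis diff_le_eq le_add_same_cancel1)
      qed
      have "?x' - y = (x - y) - block_change (p, I) (c (p, I))"
        by simp
      also have "\<dots> = (\<Sum>b\<in>S - {(p, I)}. block_change b (c b))"
        unfolding xy using sum_diff1[OF psubset.hyps(1), of "\<lambda>b. block_change b (c b)"] pI by simp
      finally show "joinable T le sim ?x' y"
        using psubset.IH[of "S - {(p, I)}" ?x' y c] pI psubset.prems(1) step y
        by (auto simp: step1_def)
    qed
    show ?thesis
    proof (cases "c (p, I) \<ge> 0")
      case True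
      then show ?thesis using reduce psubset.prems by blast
    next
      case False
      have "y - x = (\<Sum>b\<in>S. block_change b (- c b))"
        unfolding block_change_minus sum_negf psubset.prems(4)[symmetric] by simp
      then have "joinable T le sim y x"
        using reduce[of y x "\<lambda>b. - c b"] psubset.prems False by simp
      then show ?thesis by (rule joinable_sym)
    qed
  qed
qed

lemma joinable_if_diff:
  assumes "colored_tree T le sim" "x \<in> pos_cone T" "y \<in> pos_cone T"
    and "x - y \<in> change_space T le sim"
  shows "joinable T le sim x y"
  using assms joinable_if_diff_sum[OF assms(1)] unfolding change_space_def by blast

theorem theorem7p2:
  fixes T :: "'a set" and le sim :: "'a rel"
    and x y z :: "'a \<Rightarrow>\<^sub>0 'f::{division_ring, linordered_ring_strict}"
  assumes "colored_tree T le sim"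
    and "x \<in> pos_cone T" and "y \<in> pos_cone T" and "z \<in> pos_cone T"
    and "joinable T le sim (x + z) (y + z)"
  shows "joinable T le sim x y"
proof (rule joinable_if_diff[OF assms(1-3)])
  show "x - y \<in> change_space T le sim"
    using joinable_imp_diff[OF assms(5)] by simp
qed

end
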